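(* Take the damping parameter $\eta=0$. (1) For every integer $s\ge1$, the stability functions $R_{s,i}(z)$, $i=0,\dots,s$, of the internal stages of the double adjoint of the $s$-stage Chebyshev method of order one satisfy $|R_{s,i}(z)|\le1$ for all real $z\in[-2s^2,0]$. (2) For every integer $s\ge2$, the stability functions $R_{s,i}(z)$, $i=0,\dots,s$, of the internal stages of the double adjoint of the $s$-stage RKC method of order two satisfy $|R_{s,i}(z)|\le1$ for all real $z\in[-\frac23s^2+\frac23,0]$. (The polynomials $R_{s,i}$ are defined in the context for each of the two methods.)
   Context: $T_j$ denotes the Chebyshev polynomial, $T_j(\cos\theta)=\cos(j\theta)$. With damping parameter $\eta$, let $\omega_0=1+\eta/s^2$. Coefficients. Chebyshev method: $\omega=\omega_1:=T_s(\omega_0)/T_s'(\omega_0)$, $\alpha_s=1$, $a_s:=0$. RKC method: $\omega=\omega_2:=T_s'(\omega_0)/T_s''(\omega_0)$, $b_s=T_s''(\omega_0)/(T_s'(\omega_0))^2$, $a_s=1-b_sT_s(\omega_0)$, $\alpha_s=b_sT_s(\omega_0)$. In both cases $\mu_1=\omega/\omega_0$; for $i=2,\dots,s$, $\mu_i=2\omega T_{i-1}(\omega_0)/T_i(\omega_0)$ and $\nu_i=2\omega_0T_{i-1}(\omega_0)/T_i(\omega_0)$; and $\alpha_{s-1}=\nu_s\alpha_s$, $\alpha_{s-j}=\nu_{s-j+1}\alpha_{s-j+1}+(1-\nu_{s-j+2})\alpha_{s-j+2}$ for $j=2,\dots,s-1$. The underlying methods for $\dot y=F(y)$ with step $h$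 are $y_{k0}=y_k$, $y_{k1}=y_k+\mu_1hF(y_{k0})$, $y_{ki}=\mu_ihF(y_{k,i-1})+\nu_iy_{k,i-1}+(1-\nu_i)y_{k,i-2}$ ($2\le i\le s$), with $y_{k+1}=y_{ks}$ (Chebyshev) or $y_{k+1}=a_sy_{k0}+b_sT_s(\omega_0)y_{ks}$ (RKC). The double adjoint of a Runge-Kutta method $(a_{ij},b_i)$ with all $b_i\neq0$ is the Runge-Kutta method $\left(\frac{b_j}{b_i}a_{ji},b_i\right)$; for the two methods above it is implemented by a recurrence whose successive stages (computed backward in time, starting from $p_{ks}=p_{k+1}$ and ending with $p_{k0}=p_k$), when applied to the scalar linear test equation with parameter $\lambda$ and $z=h\lambda$, satisfy $p_{k,s-i}=R_{s,i}(z)p_{k+1}$, where, for $s\ge2$, $$R_{s,0}(z)=1,\qquad R_{s,1}(z)=1+\frac{\mu_s}{\nu_s}z,$$ $$R_{s,j}(z)=\frac{\alpha_{s-j+1}}{\alpha_{s-j}}(\mu_{s-j+1}z+\nu_{s-j+1})R_{s,j-1}(z)+\frac{(1-\nu_{s-j+2})\alpha_{s-j+2}}{\alpha_{s-j}}R_{s,j-2}(z),\quad j=2,\dots,s-1,$$ $$R_{s,s}(z)=\alpha_1(\mu_1z+1)R_{s,s-1}(z)+(1-\nu_2)\alpha_2R_{s,s-2}(z)+a_s.$$ For $s=1$ the Chebyshev method is the explicit Euler method, with $R_{1,0}(z)=1$, $R_{1,1}(z)=1+z$. *)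

theory Defs
  imports Complex_Main "HOL-Computational_Algebra.Polynomial"
begin

definition chebT :: "nat \<Rightarrow> real poly" where
  "chebT j = (THE p. \<forall>\<theta>::real. poly p (cos \<theta>) = cos (real j * \<theta>))"

lemma chebT_unique:
  fixes p q :: "real poly"
  assumes "\<forall>\<theta>. poly p (cos \<theta>) = cos (real j * \<theta>)"
    and "\<forall>\<theta>. poly q (cos \<theta>) = cos (real j * \<theta>)"
  shows "p = q"
proof (rule ccontr)
  assume "p \<noteq> q"
  then have "finite {x. poly (p - q) x = 0}"
    by (intro poly_roots_finite) simp
  moreover have "{-1..1} \<subseteq> {x. poly (p - q) x = 0}"
  proof
    fix x :: real
    assume "x \<in> {-1..1}"
    then have "x = cos (arccos x)" by simp
    then show "x \<in> {x. poly (p - q) x = 0}"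
      using assms by (metis (mono_tags) cancel_comm_monoid_add_class.diff_cancel mem_Collect_eq poly_diff)
  qed
  ultimately have "finite {-1..1::real}" by (rule rev_finite_subset)
  then show False by (simp add: infinite_Icc)
qed

lemma chebT_exists:
  "\<exists>p::real poly. \<forall>\<theta>. poly p (cos \<theta>) = cos (real j * \<theta>)"
proof (induction j rule: less_induct)
  case (less j)
  consider "j = 0" | "j = 1" | k where "j = Suc (Suc k)"
    by (metis One_nat_def not0_implies_Suc)
  then show ?case
  proof cases
    case 1
    then show ?thesis by (intro exI[of _ 1]) simp
  next
    case 2
    then show ?thesis by (intro exI[of _ "[:0, 1:]"]) simp
  next
    case 3
    obtain p :: "real poly" where p: "\<forall>\<theta>. poly p (cos \<theta>) = cos (real (Suc k) * \<theta>)"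
      using less 3 by blast
    obtain q :: "real poly" where q: "\<forall>\<theta>. poly q (cos \<theta>) = cos (real k * \<theta>)"
      using less[of k] 3 by auto
    have "cos (real j * \<theta>) = 2 * cos \<theta> * cos (real (Suc k) * \<theta>) - cos (real k * \<theta>)" for \<theta>
    proof -
      have "real j * \<theta> = real (Suc k) * \<theta> + \<theta>" "real k * \<theta> = real (Suc k) * \<theta> - \<theta>"
        using 3 by (simp_all add: algebra_simps)
      then show ?thesis by (simp only: cos_add cos_diff) simp
    qed
    then show ?thesis
      by (intro exI[of _ "[:0, 2:] * p - q"]) (simp add: p q)
  qed
qed

lemma poly_chebT_cos: "poly (chebT j) (cos \<theta>) = cos (real j * \<theta>)"
proof -
  have "\<exists>!p::real poly. \<forall>\<theta>. poly p (cos \<theta>) = cos (real j * \<theta>)"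
    using chebT_exists chebT_unique by blast
  from theI'[OF this] show ?thesis unfolding chebT_def by blast
qed

datatype scheme = Cheb | RKC

definition omega0 :: "real \<Rightarrow> nat \<Rightarrow> real" where
  "omega0 \<eta> s = 1 + \<eta> / (real s)^2"

fun omega :: "scheme \<Rightarrow> real \<Rightarrow> nat \<Rightarrow> real" where
  "omega Cheb \<eta> s = poly (chebT s) (omega0 \<eta> s) / poly (pderiv (chebT s)) (omega0 \<eta> s)"
| "omega RKC \<eta> s =
     poly (pderiv (chebT s)) (omega0 \<eta> s) / poly (pderiv (pderiv (chebT s))) (omega0 \<eta> s)"

definition rkc_b :: "real \<Rightarrow> nat \<Rightarrow> real" where
  "rkc_b \<eta> s =
     poly (pderiv (pderiv (chebT s))) (omega0 \<eta> s) / (poly (pderiv (chebT s)) (omega0 \<eta> s))^2"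

fun coeff_a :: "scheme \<Rightarrow> real \<Rightarrow> nat \<Rightarrow> real" where
  "coeff_a Cheb \<eta> s = 0"
| "coeff_a RKC \<eta> s = 1 - rkc_b \<eta> s * poly (chebT s) (omega0 \<eta> s)"

fun alpha_top :: "scheme \<Rightarrow> real \<Rightarrow> nat \<Rightarrow> real" where
  "alpha_top Cheb \<eta> s = 1"
| "alpha_top RKC \<eta> s = rkc_b \<eta> s * poly (chebT s) (omega0 \<eta> s)"

definition mu :: "scheme \<Rightarrow> real \<Rightarrow> nat \<Rightarrow> nat \<Rightarrow> real" where
  "mu M \<eta> s i =
     (if i = 1 then omega M \<eta> s / omega0 \<eta> s
      else 2 * omega M \<eta> s * poly (chebT (i - 1)) (omega0 \<eta> s) / poly (chebT i) (omega0 \<eta> s))"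

(* Only used for indices 2 \<le> i \<le> s; it does not depend on the scheme. *)
definition nu :: "real \<Rightarrow> nat \<Rightarrow> nat \<Rightarrow> real" where
  "nu \<eta> s i = 2 * omega0 \<eta> s * poly (chebT (i - 1)) (omega0 \<eta> s) / poly (chebT i) (omega0 \<eta> s)"

(* alpha_down M \<eta> s j is the coefficient alpha_{s-j}, for j = 0,...,s-1. In the last equation
   the index j of the recurrence is j + 2, so s - j + 1 and s - j + 2 become
   s - (j + 1) and s - j. *)
fun alpha_down :: "scheme \<Rightarrow> real \<Rightarrow> nat \<Rightarrow> nat \<Rightarrow> real" where
  "alpha_down M \<eta> s 0 = alpha_top M \<eta> s"
| "alpha_down M \<eta> s (Suc 0) = nu \<eta> s s * alpha_down M \<eta> s 0"
| "alpha_down M \<eta> s (Suc (Suc j)) =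
     nu \<eta> s (s - (j + 1)) * alpha_down M \<eta> s (Suc j)
     + (1 - nu \<eta> s (s - j)) * alpha_down M \<eta> s j"

definition alpha :: "scheme \<Rightarrow> real \<Rightarrow> nat \<Rightarrow> nat \<Rightarrow> real" where
  "alpha M \<eta> s i = alpha_down M \<eta> s (s - i)"

(* adjR M \<eta> s i z is R_{s,i}(z): applied to y' = \<lambda>y with z = h\<lambda>, the stages of the double
   adjoint, computed backward in time, are p_{k,s-i} = R_{s,i}(z) p_{k+1}, for i = 0,...,s.
   The one-stage case (explicit Euler) is separate, and the last stage i = s obeys a different
   recurrence. Index shifts are as for alpha_down. *)
fun adjR :: "scheme \<Rightarrow> real \<Rightarrow> nat \<Rightarrow> nat \<Rightarrow> real \<Rightarrow> real" where
  "adjR M \<eta> s 0 z = 1"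
| "adjR M \<eta> s (Suc 0) z = (if s = 1 then 1 + z else 1 + mu M \<eta> s s / nu \<eta> s s * z)"
| "adjR M \<eta> s (Suc (Suc j)) z =
     (if Suc (Suc j) = s
      then alpha M \<eta> s 1 * (mu M \<eta> s 1 * z + 1) * adjR M \<eta> s (Suc j) z
         + (1 - nu \<eta> s 2) * alpha M \<eta> s 2 * adjR M \<eta> s j z
         + coeff_a M \<eta> s
      else alpha M \<eta> s (s - (j + 1)) / alpha M \<eta> s (s - (j + 2))
           * (mu M \<eta> s (s - (j + 1)) * z + nu \<eta> s (s - (j + 1))) * adjR M \<eta> s (Suc j) z
         + (1 - nu \<eta> s (s - j)) * alpha M \<eta> s (s - j) / alpha M \<eta> s (s - (j + 2))
           * adjR M \<eta> s j z)"

end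

theory Submission
  imports Defs
begin

text \<open>
  Without damping \<open>\<omega>\<^sub>0 = 1\<close>, and since \<open>T\<^sub>j(1) = 1\<close> every recurrence coefficient
  degenerates: \<open>\<nu>\<^sub>i = 2\<close>, \<open>\<mu>\<^sub>i = 2\<omega>\<close> for \<open>i \<ge> 2\<close>, \<open>\<mu>\<^sub>1 = \<omega>\<close>, and the weights obey \<open>\<alpha>\<^sub>s\<^sub>-\<^sub>j = 2 \<alpha>\<^sub>s\<^sub>-\<^sub>j\<^sub>+\<^sub>1 - \<alpha>\<^sub>s\<^sub>-\<^sub>j\<^sub>+\<^sub>2\<close>,
  so they form the arithmetic progression \<open>\<alpha>\<^sub>s\<^sub>-\<^sub>j = (j + 1) \<alpha>\<^sub>s\<close>. In the variable
  \<open>x = 1 + \<omega> z\<close> the stage recurrence, multiplied by \<open>j + 1\<close>, then becomes the three-term recurrence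
  of the Chebyshev polynomials of the second kind (lemma \<open>adjR_inner_stage\<close>):
  \<open>R\<^sub>j(z) = U\<^sub>j(x) / (j + 1)\<close> for \<open>j < s\<close>. The identity \<open>x U\<^sub>s\<^sub>-\<^sub>1(x) - U\<^sub>s\<^sub>-\<^sub>2(x) = T\<^sub>s(x)\<close> turns the last
  stage into \<open>R\<^sub>s(z) = a\<^sub>s + \<alpha>\<^sub>s T\<^sub>s(x)\<close> (lemma \<open>adjR_last_stage\<close>).

  For \<open>\<bar>x\<bar> \<le> 1\<close> one has \<open>\<bar>U\<^sub>j(x)\<bar> \<le> j + 1\<close> and \<open>\<bar>T\<^sub>s(x)\<bar> \<le> 1\<close>, and \<open>a\<^sub>s + \<alpha>\<^sub>s = 1\<close> with
  \<open>0 \<le> \<alpha>\<^sub>s \<le> 1\<close>, so the last stage is a convex combination of \<open>1\<close> and \<open>T\<^sub>s(x)\<close>. The two intervals in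
  the theorem are exactly the sets of \<open>z\<close> with \<open>\<bar>1 + \<omega> z\<bar> \<le> 1\<close>: from \<open>T\<^sub>s'(1) = s\<^sup>2\<close> and
  \<open>T\<^sub>s''(1) = s\<^sup>2(s\<^sup>2 - 1)/3\<close> one gets \<open>\<omega> = 1/s\<^sup>2\<close> for the Chebyshev method and
  \<open>\<omega> = 3/(s\<^sup>2 - 1)\<close> for the RKC method. The one-stage method, explicit Euler, has
  stability function \<open>1 + z\<close> and is checked directly.
\<close>

lemma chebT_0: "chebT 0 = 1"
  by (rule chebT_unique[of _ 0]) (simp_all add: poly_chebT_cos)

lemma chebT_1: "chebT (Suc 0) = [:0, 1:]"
  by (rule chebT_unique[of _ "Suc 0"]) (simp_all add: poly_chebT_cos)

lemma cos_three_term: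
  "cos (real (Suc (Suc k)) * \<theta>) = 2 * cos \<theta> * cos (real (Suc k) * \<theta>) - cos (real k * \<theta>)"
proof -
  have "real (Suc (Suc k)) * \<theta> = real (Suc k) * \<theta> + \<theta>" "real k * \<theta> = real (Suc k) * \<theta> - \<theta>"
    by (simp_all add: algebra_simps)
  then show ?thesis by (simp only: cos_add cos_diff) simp
qed

lemma chebT_three_term: "chebT (Suc (Suc k)) = [:0, 2:] * chebT (Suc k) - chebT k"
proof (rule chebT_unique[of _ "Suc (Suc k)"])
  show "\<forall>\<theta>. poly ([:0, 2:] * chebT (Suc k) - chebT k) (cos \<theta>) = cos (real (Suc (Suc k)) * \<theta>)"
    unfolding cos_three_term by (simp add: poly_chebT_cos)
qed (simp add: poly_chebT_cos)

lemma poly_chebT_at_1: "poly (chebT k) 1 = 1"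
  using poly_chebT_cos[of k 0] by simp

lemma poly_pderiv_chebT_at_1: "poly (pderiv (chebT k)) 1 = (real k)\<^sup>2"
proof (induction k rule: induct_nat_012)
  case (ge2 n)
  then show ?case
    by (simp add: chebT_three_term pderiv_diff pderiv_mult pderiv_smult pderiv_pCons
        poly_chebT_at_1 power2_eq_square algebra_simps)
qed (simp_all add: chebT_0 chebT_1 pderiv_pCons)

lemma poly_pderiv2_chebT_at_1:
  "poly (pderiv (pderiv (chebT k))) 1 = (real k)\<^sup>2 * ((real k)\<^sup>2 - 1) / 3"
proof (induction k rule: induct_nat_012)
  case (ge2 n)
  have "poly (pderiv (pderiv (chebT (Suc (Suc n))))) 1 = 4 * poly (pderiv (chebT (Suc n))) 1
      + 2 * poly (pderiv (pderiv (chebT (Suc n)))) 1 - poly (pderiv (pderiv (chebT n))) 1"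
    by (simp add: chebT_three_term pderiv_diff pderiv_mult pderiv_add pderiv_smult pderiv_pCons)
  then show ?case
    unfolding ge2 poly_pderiv_chebT_at_1
    by (simp add: power2_eq_square field_simps)
qed (simp_all add: chebT_0 chebT_1 pderiv_pCons)

text \<open>Chebyshev polynomials of the second kind, given by their recurrence because this is the form
  in which the stage recurrence produces them.\<close>

fun chebU :: "nat \<Rightarrow> real \<Rightarrow> real" where
  "chebU 0 x = 1"
| "chebU (Suc 0) x = 2 * x"
| "chebU (Suc (Suc j)) x = 2 * x * chebU (Suc j) x - chebU j x"

text \<open>Both sides satisfy the same three-term recurrence in \<open>j\<close>, so two initial values decide.\<close>

lemma chebU_to_cos:
  "cos \<theta> * chebU (Suc j) (cos \<theta>) - chebU j (cos \<theta>) = cos (real (Suc (Suc j)) * \<theta>)"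
proof (induction j rule: induct_nat_012)
  case 0
  show ?case
    unfolding cos_three_term by (simp add: power2_eq_square)
next
  case 1
  show ?case
    unfolding cos_three_term by (simp add: power2_eq_square algebra_simps)
next
  case (ge2 n)
  show ?case
    unfolding cos_three_term[of "Suc (Suc n)"] ge2[symmetric] by (simp add: algebra_simps)
qed

text \<open>By the previous identity \<open>U\<^sub>j\<^sub>+\<^sub>1(x) = x U\<^sub>j(x) + T\<^sub>j\<^sub>+\<^sub>1(x)\<close>, so the absolute value grows by at
  most \<open>1\<close> per step. Unlike the quotient \<open>sin ((j + 1)\<theta>) / sin \<theta>\<close>, this covers \<open>x = \<plusminus>1\<close> too.\<close>

lemma abs_chebU_le: "\<bar>chebU j (cos \<theta>)\<bar> \<le> real j + 1"
proof (induction j rule: induct_nat_012)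
  case 0
  show ?case by simp
next
  case 1
  show ?case by (simp add: abs_mult)
next
  case (ge2 n)
  have "chebU (Suc (Suc n)) (cos \<theta>)
      = cos \<theta> * chebU (Suc n) (cos \<theta>) + cos (real (Suc (Suc n)) * \<theta>)"
    unfolding chebU_to_cos[symmetric] by simp
  moreover have "\<bar>cos \<theta> * chebU (Suc n) (cos \<theta>)\<bar> \<le> \<bar>chebU (Suc n) (cos \<theta>)\<bar>"
    by (simp add: abs_mult mult_left_le_one_le)
  moreover have "\<bar>cos (real (Suc (Suc n)) * \<theta>)\<bar> \<le> 1"
    by (rule abs_cos_le_one)
  ultimately show ?case
    using ge2 by linarith
qed

lemma omega0_undamped: "omega0 0 s = 1"
  by (simp add: omega0_def)

lemma nu_undamped: "nu 0 s i = 2"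
  by (simp add: nu_def omega0_undamped poly_chebT_at_1)

lemma mu_undamped: "mu M 0 s i = (if i = 1 then omega M 0 s else 2 * omega M 0 s)"
  by (simp add: mu_def omega0_undamped poly_chebT_at_1)

lemma alpha_down_undamped: "alpha_down M 0 s j = (real j + 1) * alpha_top M 0 s"
  by (induction j rule: induct_nat_012) (simp_all add: nu_undamped algebra_simps)

text \<open>The weights \<open>\<alpha>\<^sub>s\<^sub>-\<^sub>j = (j + 1) \<alpha>\<^sub>s\<close> enter the stage recurrence through ratios only, hence
  \<open>\<alpha>\<^sub>s \<noteq> 0\<close>.\<close>

lemma adjR_inner_stage:
  assumes "alpha_top M 0 s \<noteq> 0" and "j < s"
  shows "(real j + 1) * adjR M 0 s j z = chebU j (1 + omega M 0 s * z)"
  using assms(2)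
proof (induction j rule: induct_nat_012)
  case 0
  show ?case by simp
next
  case 1
  then show ?case by (simp add: mu_undamped nu_undamped)
next
  case (ge2 n)
  define x where "x = 1 + omega M 0 s * z"
  have prev: "adjR M 0 s (Suc n) z = chebU (Suc n) x / (real n + 2)"
      "adjR M 0 s n z = chebU n x / (real n + 1)"
    using ge2 by (simp_all add: x_def field_simps)
  have al: "alpha M 0 s (s - k) = (real k + 1) * alpha_top M 0 s" if "k \<le> Suc (Suc n)" for k
    using that ge2.prems by (simp add: alpha_def alpha_down_undamped)
  \<comment> \<open>Only stages with index at least 2 occur here, so the exceptional \<open>\<mu>\<^sub>1\<close> does not.\<close>
  have "mu M 0 s (s - (n + 1)) * z + nu 0 s (s - (n + 1)) = 2 * x"
    using ge2.prems by (simp add: mu_undamped nu_undamped x_def)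
  then have "adjR M 0 s (Suc (Suc n)) z
      = (real n + 2) / (real n + 3) * (2 * x) * adjR M 0 s (Suc n) z
        - (real n + 1) / (real n + 3) * adjR M 0 s n z"
    using ge2.prems assms(1) al[of "n + 1"] al[of n] al[of "n + 2"]
    by (simp add: nu_undamped add_ac)
  also have "\<dots> = chebU (Suc (Suc n)) x / (real n + 3)"
    unfolding prev by (simp add: diff_divide_distrib)
  finally have "adjR M 0 s (Suc (Suc n)) z = chebU (Suc (Suc n)) x / (real n + 3)" .
  then have "(real n + 3) * adjR M 0 s (Suc (Suc n)) z = chebU (Suc (Suc n)) x"
    by (simp del: adjR.simps chebU.simps)
  then show ?case
    by (simp add: x_def add_ac del: adjR.simps chebU.simps)
qed

lemma adjR_last_stage:
  assumes "alpha_top M 0 s \<noteq> 0" and "s \<ge> 2" and x: "1 + omega M 0 s * z = cos \<theta>"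
  shows "adjR M 0 s s z = alpha_top M 0 s * cos (real s * \<theta>) + coeff_a M 0 s"
proof -
  obtain n where s: "s = Suc (Suc n)"
    using assms(2) by (metis add_2_eq_Suc le_Suc_ex)
  have prev: "chebU (Suc n) (cos \<theta>) = (real n + 2) * adjR M 0 s (Suc n) z"
      "chebU n (cos \<theta>) = (real n + 1) * adjR M 0 s n z"
    using adjR_inner_stage[OF assms(1), of "Suc n" z] adjR_inner_stage[OF assms(1), of n z]
    by (simp_all add: s x[unfolded s] add_ac)
  have al: "alpha M 0 s 1 = (real n + 2) * alpha_top M 0 s"
      "alpha M 0 s 2 = (real n + 1) * alpha_top M 0 s"
    by (simp_all add: alpha_def alpha_down_undamped s)
  have "mu M 0 s 1 * z + 1 = cos \<theta>"
    using x by (simp add: mu_undamped)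
  then have "adjR M 0 s s z = alpha M 0 s 1 * cos \<theta> * adjR M 0 s (Suc n) z
      - alpha M 0 s 2 * adjR M 0 s n z + coeff_a M 0 s"
    by (simp add: s nu_undamped)
  also have "\<dots> = alpha_top M 0 s * (cos \<theta> * chebU (Suc n) (cos \<theta>) - chebU n (cos \<theta>))
      + coeff_a M 0 s"
    unfolding al prev by (simp add: algebra_simps)
  finally show ?thesis
    unfolding chebU_to_cos s .
qed

text \<open>The common core of both parts: consistency of the method gives \<open>a\<^sub>s + \<alpha>\<^sub>s = 1\<close>.\<close>

lemma abs_adjR_le_1:
  assumes \<alpha>: "0 < alpha_top M 0 s" "alpha_top M 0 s \<le> 1"
    and a: "coeff_a M 0 s = 1 - alpha_top M 0 s"
    and "s \<ge> 2" and "i \<le> s" and x: "\<bar>1 + omega M 0 s * z\<bar> \<le> 1"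
  shows "\<bar>adjR M 0 s i z\<bar> \<le> 1"
proof -
  obtain \<theta> where \<theta>: "1 + omega M 0 s * z = cos \<theta>"
    using cos_arccos_abs[OF x] by metis
  show ?thesis
  proof (cases "i = s")
    case True
    define c where "c = alpha_top M 0 s"
    have R: "adjR M 0 s i z = c * cos (real s * \<theta>) + (1 - c)"
      using adjR_last_stage[OF _ \<open>s \<ge> 2\<close> \<theta>] \<alpha> a True by (simp add: c_def)
    have "\<bar>c * cos (real s * \<theta>)\<bar> \<le> c"
      using \<alpha> by (simp add: c_def abs_mult mult_left_le)
    then show ?thesis
      using \<alpha> unfolding R c_def by linarith
  next
    case False
    then have "(real i + 1) * adjR M 0 s i z = chebU i (cos \<theta>)"
      using adjR_inner_stage[of M s i z] \<alpha> \<open>i \<le> s\<close> \<theta> by simp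
    then have "(real i + 1) * \<bar>adjR M 0 s i z\<bar> \<le> real i + 1"
      using abs_chebU_le[of i \<theta>] by (metis abs_mult abs_of_nonneg of_nat_0_le_iff
          add_nonneg_nonneg zero_le_one)
    then show ?thesis
      by (simp add: mult_le_cancel_left1)
  qed
qed

lemma omega_Cheb_undamped: "omega Cheb 0 s = 1 / (real s)\<^sup>2"
  by (simp add: omega0_undamped poly_chebT_at_1 poly_pderiv_chebT_at_1)

lemma omega_RKC_undamped: "s \<ge> 2 \<Longrightarrow> omega RKC 0 s = 3 / ((real s)\<^sup>2 - 1)"
  by (simp add: omega0_undamped poly_pderiv_chebT_at_1 poly_pderiv2_chebT_at_1)

lemma rkc_b_undamped: "s \<ge> 2 \<Longrightarrow> rkc_b 0 s = ((real s)\<^sup>2 - 1) / (3 * (real s)\<^sup>2)"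
  by (simp add: rkc_b_def omega0_undamped poly_pderiv_chebT_at_1 poly_pderiv2_chebT_at_1
      power2_eq_square)

theorem theorem3p6:
  "(\<forall>s::nat. s \<ge> 1 \<longrightarrow>
      (\<forall>i\<le>s. \<forall>z::real. z \<in> {- 2 * (real s)^2 .. 0} \<longrightarrow> \<bar>adjR Cheb 0 s i z\<bar> \<le> 1)) \<and>
   (\<forall>s::nat. s \<ge> 2 \<longrightarrow>
      (\<forall>i\<le>s. \<forall>z::real. z \<in> {- (2/3) * (real s)^2 + 2/3 .. 0} \<longrightarrow> \<bar>adjR RKC 0 s i z\<bar> \<le> 1))"
proof (intro conjI allI impI)
  fix s i :: nat and z :: real
  assume s: "s \<ge> 1" and i: "i \<le> s" and z: "z \<in> {- 2 * (real s)^2 .. 0}"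
  show "\<bar>adjR Cheb 0 s i z\<bar> \<le> 1"
  proof (cases "s = 1")
    case True
    then have "i = 0 \<or> i = 1" using i by auto
    then show ?thesis using z True by auto
  next
    case False
    have "(real s)\<^sup>2 > 0" using s by simp
    then have "\<bar>1 + omega Cheb 0 s * z\<bar> \<le> 1"
      using z unfolding omega_Cheb_undamped by (auto simp: abs_le_iff field_simps)
    then show ?thesis
      using False s i by (intro abs_adjR_le_1) auto
  qed
next
  fix s i :: nat and z :: real
  assume s: "s \<ge> 2" and i: "i \<le> s" and z: "z \<in> {- (2/3) * (real s)^2 + 2/3 .. 0}"
  have s2: "(real s)\<^sup>2 > 1" using s by simp
  have b: "0 < rkc_b 0 s" "rkc_b 0 s \<le> 1"
    using s2 s by (simp_all add: rkc_b_undamped field_simps)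
  have top: "alpha_top RKC 0 s = rkc_b 0 s"
    by (simp add: omega0_undamped poly_chebT_at_1)
  have "\<bar>1 + omega RKC 0 s * z\<bar> \<le> 1"
    using z s2 unfolding omega_RKC_undamped[OF s] by (auto simp: abs_le_iff field_simps)
  then show "\<bar>adjR RKC 0 s i z\<bar> \<le> 1"
    using s i b unfolding top[symmetric] by (intro abs_adjR_le_1) simp_all
qed

end
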